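(* Let $G$ be a connected graph of order $n$. Then $$\partial_1^{Q}(G)\le \frac{2W(G)}{n}+\sqrt{\frac{n-1}{n}\left(\|\mathcal{Q}(G)\|_F^2-\frac{(2W(G))^2}{n}\right)}.$$ Equality holds if and only if $G=K_n$.
   Context: Graphs are finite, simple and undirected. For a connected graph $G$ with vertices $v_1,\ldots,v_n$, $d(u,v)$ is the length of a shortest path between $u$ and $v$; the distance matrix is $\mathcal{D}(G)=(d(v_i,v_j))_{i,j}$; the transmission of a vertex is $Tr(v)=\sum_{u\in V(G)}d(v,u)$; $Tr(G)=\mathrm{diag}[Tr(v_1),\ldots,Tr(v_n)]$. The Wiener index is $W(G)=\frac12\sum_{u,v\in V(G)}d(u,v)$ (sum over ordered pairs). The distance signless Laplacian matrix is $\mathcal{Q}(G)=Tr(G)+\mathcal{D}(G)$, with eigenvalues $\partial_1^{Q}(G)\ge\cdots\ge\partial_n^{Q}(G)$. $\|M\|_F=\sqrt{\sum_{i,j}|m_{i,j}|^2}$ is the Frobenius norm, and $K_n$ is the complete graph on $n$ vertices. *)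

theory Defs
  imports
    Complex_Main
    "Graph_Theory.Graph_Theory"
    "Jordan_Normal_Form.Char_Poly"
begin

text \<open>
  Finite simple undirected graphs are the \<^locale>\<open>graph\<close>s of the library: finite, loop-free
  symmetric digraphs without parallel arcs, each edge being a pair of opposite arcs.
\<close>

definition graph_dist :: "('a, 'b) pre_digraph \<Rightarrow> 'a \<Rightarrow> 'a \<Rightarrow> nat" where
  "graph_dist G u v = (LEAST k. \<exists>p. pre_digraph.apath G u p v \<and> length p = k)"

lemma (in fin_digraph) graph_dist_conv_\<mu>:
  assumes "u \<rightarrow>\<^sup>* v"
  shows "ereal (real (graph_dist G u v)) = \<mu> (\<lambda>_. 1) u v"
proof -
  have cost: "awalk_cost (\<lambda>_. 1) p = real (length p)" for p
    by (induct p) auto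
  obtain p where p: "apath u p v" "\<mu> (\<lambda>_. 1) u v = ereal (real (length p))"
    using min_cost_awalk[OF assms, of "\<lambda>_. 1"] by (auto simp: cost)
  have "length p \<le> length q" if "apath u q v" for q
    using min_cost_le_walk_cost[of u q v "\<lambda>_. 1"] that p(2) by (auto simp: cost apath_def)
  then have "graph_dist G u v = length p"
    unfolding graph_dist_def using p(1) by (intro Least_equality) auto
  with p(2) show ?thesis by simp
qed

definition transmission :: "('a, 'b) pre_digraph \<Rightarrow> 'a \<Rightarrow> nat" where
  "transmission G v = (\<Sum>u\<in>verts G. graph_dist G v u)"

definition wiener_index :: "('a, 'b) pre_digraph \<Rightarrow> real" where
  "wiener_index G = (1 / 2) * (\<Sum>u\<in>verts G. \<Sum>v\<in>verts G. real (graph_dist G u v))"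

text \<open>
  The list \<open>vs\<close> in the following definitions is the enumeration of the vertices that indexes the
  rows and columns of the matrix: it lists every vertex exactly once.
\<close>

definition distance_matrix :: "('a, 'b) pre_digraph \<Rightarrow> 'a list \<Rightarrow> real mat" where
  "distance_matrix G vs =
    mat (length vs) (length vs) (\<lambda>(i, j). real (graph_dist G (vs ! i) (vs ! j)))"

definition transmission_matrix :: "('a, 'b) pre_digraph \<Rightarrow> 'a list \<Rightarrow> real mat" where
  "transmission_matrix G vs = mat_diag (length vs) (\<lambda>i. real (transmission G (vs ! i)))"

definition distance_signless_laplacian :: "('a, 'b) pre_digraph \<Rightarrow> 'a list \<Rightarrow> real mat" where
  "distance_signless_laplacian G vs = transmission_matrix G vs + distance_matrix G vs"

definition frobenius_norm :: "real mat \<Rightarrow> real" where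
  "frobenius_norm M = sqrt (\<Sum>i<dim_row M. \<Sum>j<dim_col M. \<bar>M $$ (i, j)\<bar>\<^sup>2)"

text \<open>
  The \<open>i\<close>-th largest real eigenvalue, counted with algebraic multiplicity and from \<open>i = 1\<close>.
  For a symmetric real matrix of size \<open>n\<close> the list has all \<open>n\<close> eigenvalues.
\<close>

definition nth_largest_eigenvalue :: "real mat \<Rightarrow> nat \<Rightarrow> real" where
  "nth_largest_eigenvalue M i = rev (sorted_list_of_multiset (proots (char_poly M))) ! (i - 1)"

end

theory Submission
  imports Defs "HOL-Computational_Algebra.Fundamental_Theorem_Algebra"
begin

text \<open>
  Let \<open>k\<close> be any eigenvalue of a real \<open>n \<times> n\<close> matrix \<open>A\<close>, with \<open>n \<ge> 2\<close> and real eigenvector \<open>v\<close>,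
  and let \<open>t\<close> be the trace of \<open>A\<close>. Compare \<open>A\<close> with the matrix \<open>\<mu> I + c v v\<^sup>T\<close> that has the
  eigenvalue \<open>k\<close> on \<open>v\<close> and, on the orthogonal complement of \<open>v\<close>, the mean
  \<open>\<mu> = (t - k) / (n - 1)\<close> of the other eigenvalues. The squared Frobenius norm of the difference
  is \<open>D = \<parallel>A\<parallel>\<^sup>2 - k\<^sup>2 - (t - k)\<^sup>2 / (n - 1)\<close> (lemma \<open>frobenius_residual\<close>), and
  \<open>(n - 1) / n * (\<parallel>A\<parallel>\<^sup>2 - t\<^sup>2 / n) = (k - t / n)\<^sup>2 + (n - 1) / n * D\<close>. So \<open>D \<ge> 0\<close> is the bound
  \<open>k \<le> t / n + sqrt ((n - 1) / n * (\<parallel>A\<parallel>\<^sup>2 - t\<^sup>2 / n))\<close>, and equality forces \<open>D = 0\<close>, that is,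
  \<open>A = \<mu> I + c v v\<^sup>T\<close> (lemma \<open>eigenvalue_le_trace_frobenius\<close>). This replaces the usual
  Cauchy-Schwarz argument on the list of all eigenvalues, and with it the spectral theorem:
  symmetry serves only to show that a real eigenvalue exists, so that the largest one is an
  eigenvalue. For the distance signless Laplacian, \<open>t\<close> is twice the Wiener index.

  Suppose that the distance signless Laplacian of a connected graph has the form
  \<open>\<mu> I + c v v\<^sup>T\<close>. If the graph is not complete, it has an induced path \<open>x, y, z\<close>, with
  distances 1, 1 and 2. The off-diagonal entries give \<open>c v\<^sub>x v\<^sub>y = c v\<^sub>y v\<^sub>z = 1\<close> and
  \<open>c v\<^sub>x v\<^sub>z = 2\<close>, hence \<open>c v\<^sub>x\<^sup>2 = 2\<close> and \<open>c v\<^sub>y\<^sup>2 = 1/2\<close>, and then the diagonal entries say that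
  the transmissions of \<open>x\<close> and \<open>y\<close> differ by \<open>3/2\<close>, although both are integers
  (lemma \<open>rank_one_perturbation_imp_complete\<close>). Conversely, in \<open>K\<^sub>n\<close> the all-ones vector has
  eigenvalue \<open>2 (n - 1)\<close>, which is the value of the bound.
\<close>

section \<open>Distances in a connected graph\<close>

text \<open>
  Distances are defined by paths without repeated vertices. Arbitrary walks give the same
  minimum, and they are easier to concatenate and to reverse.
\<close>

lemma (in fin_digraph) graph_dist_le_length:
  assumes "awalk u p v"
  shows "graph_dist G u v \<le> length p"
proof -
  have "awalk_cost (\<lambda>_. 1) q = real (length q)" for q
    by (induct q) auto
  moreover have "u \<rightarrow>\<^sup>* v"
    using assms by (rule reachable_awalkI)
  ultimately have "ereal (real (graph_dist G u v)) \<le> ereal (real (length p))"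
    using min_cost_le_walk_cost[OF assms, of "\<lambda>_. 1"] by (simp add: graph_dist_conv_\<mu>)
  then show ?thesis
    by simp
qed

lemma (in fin_digraph) graph_dist_awalk_exists:
  assumes "u \<rightarrow>\<^sup>* v"
  shows "\<exists>p. awalk u p v \<and> length p = graph_dist G u v"
proof -
  have "\<exists>k p. apath u p v \<and> length p = k"
    using assms by (simp add: reachable_apath)
  then have "\<exists>p. apath u p v \<and> length p = graph_dist G u v"
    unfolding graph_dist_def by (rule LeastI_ex)
  then show ?thesis
    by (auto intro: awalkI_apath)
qed

lemma (in sym_digraph) awalk_reversed_exists:
  "awalk u p v \<Longrightarrow> \<exists>q. awalk v q u \<and> length q = length p"
proof (induction p arbitrary: u)
  case Nil
  then show ?case
    by (auto simp: awalk_Nil_iff)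
next
  case (Cons e p)
  then obtain q where q: "awalk v q (head G e)" "length q = length p"
    and e: "e \<in> arcs G" "tail G e = u"
    by (auto simp: awalk_Cons_iff)
  obtain e' where "e' \<in> arcs G" "tail G e' = head G e" "head G e' = u"
    using sym_arcs e unfolding symmetric_conv by force
  then have "awalk (head G e) [e'] u"
    using arc_implies_awalk[of e'] by simp
  with q show ?case
    by (intro exI[of _ "q @ [e']"]) (auto intro: awalk_appendI simp del: awalk_append_iff)
qed

lemma (in pseudo_graph) graph_dist_commute:
  assumes "u \<rightarrow>\<^sup>* v"
  shows "graph_dist G u v = graph_dist G v u"
proof -
  have le: "graph_dist G b a \<le> graph_dist G a b" if "a \<rightarrow>\<^sup>* b" for a b
    using graph_dist_awalk_exists[OF that] awalk_reversed_exists graph_dist_le_length by metis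
  have "v \<rightarrow>\<^sup>* u"
    using symmetric_reachable[OF sym_arcs assms] .
  with assms show ?thesis
    by (intro antisym le)
qed

lemma (in fin_digraph) graph_dist_self:
  assumes "u \<in> verts G"
  shows "graph_dist G u u = 0"
  using graph_dist_le_length[of u "[]" u] assms by (simp add: awalk_Nil_iff)

lemma (in fin_digraph) graph_dist_adjacent:
  assumes "u \<rightarrow>\<^bsub>G\<^esub> v" and "u \<noteq> v"
  shows "graph_dist G u v = 1"
proof -
  obtain e where e: "e \<in> arcs G" "tail G e = u" "head G e = v"
    using assms(1) by (rule reachableE)
  have "graph_dist G u v \<le> 1"
    using graph_dist_le_length[of u "[e]" v] e by (auto simp: awalk_simps)
  moreover have "graph_dist G u v \<noteq> 0"
  proof
    assume "graph_dist G u v = 0"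
    then have "awalk u [] v"
      using graph_dist_awalk_exists[of u v] assms(1) by auto
    with assms(2) show False
      by (simp add: awalk_Nil_iff)
  qed
  ultimately show ?thesis
    by simp
qed

lemma (in fin_digraph) graph_dist_common_neighbour:
  assumes "u \<rightarrow>\<^bsub>G\<^esub> v" and "v \<rightarrow>\<^bsub>G\<^esub> w" and "u \<noteq> w" and "\<not> u \<rightarrow>\<^bsub>G\<^esub> w"
  shows "graph_dist G u w = 2"
proof -
  obtain e where e: "e \<in> arcs G" "tail G e = u" "head G e = v"
    using assms(1) by (rule reachableE)
  obtain f where f: "f \<in> arcs G" "tail G f = v" "head G f = w"
    using assms(2) by (rule reachableE)
  have "graph_dist G u w \<le> 2"
    using graph_dist_le_length[of u "[e, f]" w] e f by (auto simp: awalk_simps)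
  moreover have "graph_dist G u w \<notin> {0, 1}"
  proof
    obtain p where p: "awalk u p w" "length p = graph_dist G u w"
      using graph_dist_awalk_exists[of u w] assms(1,2) by (auto intro: reachable_trans)
    assume "graph_dist G u w \<in> {0, 1}"
    then have "p = [] \<or> (\<exists>g. p = [g])"
      using p(2) by (auto simp: length_Suc_conv)
    with p(1) assms(3,4) show False
      by (auto simp: awalk_simps arcs_ends_conv)
  qed
  ultimately show ?thesis
    by auto
qed

lemma (in graph) connected_imp_reachable:
  assumes "Digraph_Component.connected G" and "u \<in> verts G" and "v \<in> verts G"
  shows "u \<rightarrow>\<^sup>* v"
proof -
  have "u \<rightarrow>\<^sup>*\<^bsub>mk_symmetric G\<^esub> v"
    using assms unfolding connected_def strongly_connected_def by simp
  then show ?thesis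
    by (simp only: reachable_mk_symmetric_eq[OF sym_arcs])
qed

text \<open>
  If any two ends of a path with two arcs are adjacent, then shortening a walk one step at a time
  reduces reachability to adjacency. A connected graph that is not complete therefore has an
  induced path on three vertices.
\<close>

lemma (in wf_digraph) transitive_reachable_imp_adjacent:
  assumes tr: "\<And>a b c. a \<rightarrow>\<^bsub>G\<^esub> b \<Longrightarrow> b \<rightarrow>\<^bsub>G\<^esub> c \<Longrightarrow> a \<noteq> c \<Longrightarrow> a \<rightarrow>\<^bsub>G\<^esub> c"
    and "u \<rightarrow>\<^sup>* v" and "u \<noteq> v"
  shows "u \<rightarrow>\<^bsub>G\<^esub> v"
proof -
  have "u = v \<or> u \<rightarrow>\<^bsub>G\<^esub> v"
    using assms(2)
  proof (induction rule: reachable_induct)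
    case base
    then show ?case by simp
  next
    case (step x y)
    then show ?case using tr by blast
  qed
  with assms(3) show ?thesis by simp
qed

lemma (in graph) connected_not_complete_imp_induced_path:
  assumes "Digraph_Component.connected G" and "\<not> complete_digraph (card (verts G)) G"
  obtains u v w where "u \<rightarrow>\<^bsub>G\<^esub> v" "v \<rightarrow>\<^bsub>G\<^esub> w" "u \<noteq> w" "\<not> u \<rightarrow>\<^bsub>G\<^esub> w"
proof (rule ccontr)
  assume "\<not> thesis"
  with that have "\<And>a b c. a \<rightarrow>\<^bsub>G\<^esub> b \<Longrightarrow> b \<rightarrow>\<^bsub>G\<^esub> c \<Longrightarrow> a \<noteq> c \<Longrightarrow> a \<rightarrow>\<^bsub>G\<^esub> c"
    by blast
  then have "a \<rightarrow>\<^bsub>G\<^esub> b" if "a \<in> verts G" "b \<in> verts G" "a \<noteq> b" for a b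
    using transitive_reachable_imp_adjacent connected_imp_reachable[OF assms(1)] that by blast
  then have "(a, b) \<in> arcs_ends G \<longleftrightarrow> a \<in> verts G \<and> b \<in> verts G \<and> a \<noteq> b" for a b
    by (metis adj_in_verts adj_not_same)
  then have "arcs_ends G = {(a, b). (a, b) \<in> verts G \<times> verts G \<and> a \<noteq> b}"
    by (simp add: set_eq_iff)
  moreover have "graph G" by unfold_locales
  ultimately show False
    using assms(2) by (simp add: complete_digraph_def)
qed

section \<open>The largest eigenvalue of a real symmetric matrix\<close>

lemma mult_mat_vec_index_sum:
  assumes "A \<in> carrier_mat n n" and "v \<in> carrier_vec n" and "i < n"
  shows "(A *\<^sub>v v) $ i = (\<Sum>j<n. A $$ (i, j) * v $ j)"
  using assms by (auto simp: scalar_prod_def lessThan_atLeast0)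

lemma sum_sq_pos:
  assumes "v \<in> carrier_vec n" and "v \<noteq> 0\<^sub>v n"
  shows "0 < (\<Sum>i<n. (v $ i :: real)\<^sup>2)"
proof -
  obtain i where "i < n" "v $ i \<noteq> 0"
    using assms by force
  then show ?thesis
    by (intro sum_pos2[of _ i]) auto
qed

text \<open>
  For an eigenvector \<open>a + i b\<close> of a real symmetric matrix \<open>A\<close> with eigenvalue \<open>k\<close>, the real and
  imaginary parts of the eigenvalue equation express \<open>A a\<close> and \<open>A b\<close> by \<open>a\<close> and \<open>b\<close>; by symmetry
  \<open>b \<bullet> A a = a \<bullet> A b\<close>, which becomes \<open>Im k * (\<parallel>a\<parallel>\<^sup>2 + \<parallel>b\<parallel>\<^sup>2) = 0\<close>.
\<close>

lemma real_symmetric_complex_eigenvalue_is_real: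
  fixes A :: "real mat"
  assumes A: "A \<in> carrier_mat n n"
    and sym: "\<And>i j. i < n \<Longrightarrow> j < n \<Longrightarrow> A $$ (i, j) = A $$ (j, i)"
    and ev: "eigenvalue (map_mat complex_of_real A) k"
  shows "k \<in> \<real>"
proof -
  obtain v where v: "v \<in> carrier_vec n" "v \<noteq> 0\<^sub>v n"
    and eq: "map_mat complex_of_real A *\<^sub>v v = k \<cdot>\<^sub>v v"
    using ev A unfolding eigenvalue_def eigenvector_def by auto
  define a where "a i = Re (v $ i)" for i
  define b where "b i = Im (v $ i)" for i
  have row: "(\<Sum>j<n. of_real (A $$ (i, j)) * v $ j) = k * v $ i" if "i < n" for i
  proof -
    have "(\<Sum>j<n. of_real (A $$ (i, j)) * v $ j) = (map_mat complex_of_real A *\<^sub>v v) $ i"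
      using mult_mat_vec_index_sum[of "map_mat complex_of_real A" n v i] A v that by simp
    with eq v that show ?thesis by simp
  qed
  have re: "(\<Sum>j<n. A $$ (i, j) * a j) = Re k * a i - Im k * b i"
    and im: "(\<Sum>j<n. A $$ (i, j) * b j) = Re k * b i + Im k * a i" if "i < n" for i
    using arg_cong[OF row[OF that], of Re] arg_cong[OF row[OF that], of Im]
    by (simp_all add: a_def b_def)
  have "(\<Sum>i<n. b i * (\<Sum>j<n. A $$ (i, j) * a j)) = (\<Sum>j<n. \<Sum>i<n. b i * (A $$ (i, j) * a j))"
    by (subst sum.swap) (simp add: sum_distrib_left)
  also have "\<dots> = (\<Sum>j<n. a j * (\<Sum>i<n. A $$ (j, i) * b i))"
    by (intro sum.cong refl) (auto simp: sum_distrib_left sym intro!: sum.cong)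
  finally have "(\<Sum>i<n. b i * (Re k * a i - Im k * b i)) = (\<Sum>i<n. a i * (Re k * b i + Im k * a i))"
    by (simp add: re im)
  then have "(\<Sum>i<n. Im k * ((a i)\<^sup>2 + (b i)\<^sup>2)) = 0"
    by (simp add: algebra_simps power2_eq_square sum.distrib sum_subtractf)
  then have "Im k * (\<Sum>i<n. (a i)\<^sup>2 + (b i)\<^sup>2) = 0"
    by (simp add: sum_distrib_left)
  moreover have "0 < (\<Sum>i<n. (a i)\<^sup>2 + (b i)\<^sup>2)"
  proof -
    obtain i where i: "i < n" "v $ i \<noteq> 0"
      using v by force
    then have "0 < (a i)\<^sup>2 + (b i)\<^sup>2"
      by (simp add: a_def b_def complex_eq_iff sum_power2_gt_zero_iff)
    with i show ?thesis
      by (intro sum_pos2[of _ i]) auto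
  qed
  ultimately have "Im k = 0" by simp
  then show ?thesis by (simp add: complex_is_Real_iff)
qed

lemma real_symmetric_eigenvalue_exists:
  fixes A :: "real mat"
  assumes A: "A \<in> carrier_mat n n" and "n > 0"
    and sym: "\<And>i j. i < n \<Longrightarrow> j < n \<Longrightarrow> A $$ (i, j) = A $$ (j, i)"
  shows "\<exists>r. eigenvalue A r"
proof -
  let ?C = "map_mat complex_of_real A"
  have C: "?C \<in> carrier_mat n n" using A by simp
  have "degree (char_poly ?C) = n"
    using degree_monic_char_poly[OF C] by simp
  then obtain z where z: "poly (char_poly ?C) z = 0"
    using fundamental_theorem_of_algebra[of "char_poly ?C"] \<open>n > 0\<close> by (auto simp: constant_degree)
  then have "eigenvalue ?C z"
    using eigenvalue_root_char_poly[OF C] by simp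
  then have "z \<in> \<real>"
    using real_symmetric_complex_eigenvalue_is_real[OF A sym] by simp
  then obtain r where "z = of_real r"
    by (auto elim: Reals_cases)
  with z have "poly (char_poly A) r = 0"
    by (simp add: of_real_hom.char_poly_hom[OF A])
  then show ?thesis
    using eigenvalue_root_char_poly[OF A] by auto
qed

lemma last_sorted_list_of_multiset:
  assumes "M \<noteq> {#}"
  shows "last (sorted_list_of_multiset M) \<in># M"
    and "x \<in># M \<Longrightarrow> x \<le> last (sorted_list_of_multiset M)"
proof -
  let ?xs = "sorted_list_of_multiset M"
  have set: "set ?xs = set_mset M"
    by simp
  with assms have "?xs \<noteq> []"
    by (metis list.set(1) set_mset_eq_empty_iff)
  then show "last ?xs \<in># M"
    using last_in_set[of ?xs] unfolding set by blast
  show "x \<le> last ?xs" if "x \<in># M"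
  proof -
    have "x \<in> set ?xs"
      using that by simp
    then obtain i where i: "i < length ?xs" "?xs ! i = x"
      unfolding in_set_conv_nth by blast
    have "?xs ! i \<le> ?xs ! (length ?xs - 1)"
      by (rule sorted_nth_mono) (use i in simp_all)
    with i(2) show ?thesis
      by (simp add: last_conv_nth[OF \<open>?xs \<noteq> []\<close>])
  qed
qed

text \<open>
  Symmetry makes the list of real eigenvalues nonempty; on an empty list the first entry would be
  an unspecified number.
\<close>

lemma nth_largest_eigenvalue_1_greatest:
  fixes A :: "real mat"
  assumes A: "A \<in> carrier_mat n n" and "n > 0"
    and sym: "\<And>i j. i < n \<Longrightarrow> j < n \<Longrightarrow> A $$ (i, j) = A $$ (j, i)"
  shows "eigenvalue A (nth_largest_eigenvalue A 1)"
    and "eigenvalue A r \<Longrightarrow> r \<le> nth_largest_eigenvalue A 1"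
proof -
  let ?M = "proots (char_poly A)"
  have "char_poly A \<noteq> 0"
    using degree_monic_char_poly[OF A] by auto
  then have roots: "x \<in># ?M \<longleftrightarrow> eigenvalue A x" for x
    using eigenvalue_root_char_poly[OF A] by simp
  then have ne: "?M \<noteq> {#}"
    using real_symmetric_eigenvalue_exists[OF A \<open>n > 0\<close> sym] by fastforce
  then have "sorted_list_of_multiset ?M \<noteq> []"
    by (metis mset_sorted_list_of_multiset mset.simps(1))
  then have eq: "nth_largest_eigenvalue A 1 = last (sorted_list_of_multiset ?M)"
    by (simp add: nth_largest_eigenvalue_def last_conv_nth rev_nth)
  show "eigenvalue A (nth_largest_eigenvalue A 1)"
    using last_sorted_list_of_multiset(1)[OF ne] roots by (simp only: eq)
  show "r \<le> nth_largest_eigenvalue A 1" if "eigenvalue A r"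
    using last_sorted_list_of_multiset(2)[OF ne] roots that by (simp only: eq)
qed

section \<open>Trace, Frobenius norm and a single eigenvalue\<close>

text \<open>
  Expand the square. With \<open>s = \<parallel>v\<parallel>\<^sup>2\<close>, the inner products of \<open>A\<close>, \<open>I\<close> and \<open>v v\<^sup>T\<close> with each other
  are \<open>\<langle>A, I\<rangle> = t\<close>, \<open>\<langle>A, v v\<^sup>T\<rangle> = k s\<close>, \<open>\<langle>I, v v\<^sup>T\<rangle> = s\<close>, \<open>\<langle>I, I\<rangle> = n\<close> and
  \<open>\<langle>v v\<^sup>T, v v\<^sup>T\<rangle> = s\<^sup>2\<close>. The coefficient \<open>c\<close> makes \<open>v\<close> an eigenvector of \<open>\<mu> I + c v v\<^sup>T\<close> for \<open>k\<close>,
  and \<open>\<mu>\<close> gives that matrix the trace \<open>t\<close>.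
\<close>

lemma frobenius_residual:
  fixes A :: "real mat" and t \<mu> :: real
  assumes A: "A \<in> carrier_mat n n" and "n \<ge> 2" and ev: "eigenvector A v k"
    and t: "t = (\<Sum>i<n. A $$ (i, i))"
  defines "\<mu> \<equiv> (t - k) / (real n - 1)"
  defines "c \<equiv> (k - \<mu>) / (\<Sum>i<n. (v $ i)\<^sup>2)"
  shows "(\<Sum>i<n. \<Sum>j<n. (A $$ (i, j) - \<mu> * of_bool (i = j) - c * (v $ i * v $ j))\<^sup>2) =
    (frobenius_norm A)\<^sup>2 - k\<^sup>2 - (t - k)\<^sup>2 / (real n - 1)"
proof -
  have v: "v \<in> carrier_vec n" "v \<noteq> 0\<^sub>v n" and eq: "A *\<^sub>v v = k \<cdot>\<^sub>v v"
    using ev A unfolding eigenvector_def by auto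
  have row: "(\<Sum>j<n. A $$ (i, j) * v $ j) = k * v $ i" if "i < n" for i
    using mult_mat_vec_index_sum[OF A v(1) that] eq v that by simp
  define s where "s = (\<Sum>i<n. (v $ i)\<^sup>2)"
  have "s > 0"
    unfolding s_def using v by (rule sum_sq_pos)
  then have cs: "c * s = k - \<mu>"
    by (simp add: c_def s_def)
  have F: "(frobenius_norm A)\<^sup>2 = (\<Sum>i<n. \<Sum>j<n. (A $$ (i, j))\<^sup>2)"
    using A by (simp add: frobenius_norm_def sum_nonneg)
  have quad: "(\<Sum>i<n. \<Sum>j<n. A $$ (i, j) * (v $ i * v $ j)) = k * s"
  proof -
    have "(\<Sum>i<n. \<Sum>j<n. A $$ (i, j) * (v $ i * v $ j)) =
        (\<Sum>i<n. v $ i * (\<Sum>j<n. A $$ (i, j) * v $ j))"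
      by (simp add: sum_distrib_left mult.left_commute)
    also have "\<dots> = k * s"
      by (simp add: row s_def sum_distrib_left power2_eq_square mult.left_commute)
    finally show ?thesis .
  qed
  have vv: "(\<Sum>i<n. \<Sum>j<n. (v $ i * v $ j)\<^sup>2) = s\<^sup>2"
    unfolding s_def power2_eq_square[of "sum _ _"] by (simp add: sum_product power_mult_distrib)
  have dA: "(\<Sum>i<n. \<Sum>j<n. of_bool (i = j) * A $$ (i, j)) = t"
    by (simp add: t of_bool_def if_distrib[of "\<lambda>x. x * _"] cong: if_cong)
  have dv: "(\<Sum>i<n. \<Sum>j<n. of_bool (i = j) * (v $ i * v $ j)) = s"
    by (simp add: s_def of_bool_def if_distrib[of "\<lambda>x. x * _"] power2_eq_square cong: if_cong)
  have dd: "(\<Sum>i<n. \<Sum>j<n. of_bool (i = j)) = real n"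
    by (simp add: of_bool_def)
  have "(A $$ (i, j) - \<mu> * of_bool (i = j) - c * (v $ i * v $ j))\<^sup>2 =
      (A $$ (i, j))\<^sup>2 + \<mu>\<^sup>2 * of_bool (i = j) + c\<^sup>2 * (v $ i * v $ j)\<^sup>2
      - 2 * \<mu> * (of_bool (i = j) * A $$ (i, j)) - 2 * c * (A $$ (i, j) * (v $ i * v $ j))
      + 2 * \<mu> * c * (of_bool (i = j) * (v $ i * v $ j))" for i j
    by (cases "i = j") (simp_all add: power2_eq_square algebra_simps)
  then have "(\<Sum>i<n. \<Sum>j<n. (A $$ (i, j) - \<mu> * of_bool (i = j) - c * (v $ i * v $ j))\<^sup>2) =
      (frobenius_norm A)\<^sup>2 + \<mu>\<^sup>2 * real n + c\<^sup>2 * s\<^sup>2 - 2 * \<mu> * t - 2 * c * (k * s) + 2 * \<mu> * c * s"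
    by (simp only: sum.distrib sum_subtractf flip: sum_distrib_left) (simp only: F quad vv dA dv dd)
  also have "\<dots> = (frobenius_norm A)\<^sup>2 + \<mu>\<^sup>2 * real n + (c * s)\<^sup>2 - 2 * \<mu> * t
      - 2 * k * (c * s) + 2 * \<mu> * (c * s)"
    by (simp add: power_mult_distrib)
  also have "\<dots> = (frobenius_norm A)\<^sup>2 - k\<^sup>2 + \<mu> * (\<mu> * (real n - 1) - 2 * (t - k))"
    unfolding cs by (simp add: power2_eq_square algebra_simps)
  also have "\<mu> * (real n - 1) = t - k"
    using \<open>n \<ge> 2\<close> by (simp add: \<mu>_def)
  also have "\<mu> * (t - k - 2 * (t - k)) = - (\<mu> * (t - k))"
    by (simp add: algebra_simps)
  also have "\<mu> * (t - k) = (t - k)\<^sup>2 / (real n - 1)"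
    by (simp add: \<mu>_def power2_eq_square)
  also have "(frobenius_norm A)\<^sup>2 - k\<^sup>2 + - ((t - k)\<^sup>2 / (real n - 1)) =
      (frobenius_norm A)\<^sup>2 - k\<^sup>2 - (t - k)\<^sup>2 / (real n - 1)"
    by simp
  finally show ?thesis .
qed

text \<open>
  Completing the square in \<open>k\<close> turns a statement about the sign of the residual into one about the
  distance of \<open>k\<close> from the mean \<open>t / N\<close> of the eigenvalues.
\<close>

lemma eigenvalue_bound_identity:
  fixes N t F k :: real
  assumes "N > 1"
  shows "(N - 1) / N * (F - t\<^sup>2 / N) = (k - t / N)\<^sup>2 + (N - 1) / N * (F - k\<^sup>2 - (t - k)\<^sup>2 / (N - 1))"
proof -
  define q where "q = (t - k)\<^sup>2 / (N - 1)"
  define r where "r = t / N"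
  have "(N - 1) * q = (t - k)\<^sup>2" and t: "t = N * r"
    using assms by (simp_all add: q_def r_def)
  then have q: "(N - 1) * q = (N * r - k)\<^sup>2"
    by simp
  have "(N - 1) * (F - t\<^sup>2 / N) = (N - 1) * F - (N - 1) * N * r\<^sup>2"
    using assms by (simp add: t power2_eq_square algebra_simps)
  also have "\<dots> = N * (k - r)\<^sup>2 + ((N - 1) * F - (N - 1) * k\<^sup>2 - (N * r - k)\<^sup>2)"
    by (simp add: power2_eq_square algebra_simps)
  also have "\<dots> = N * (k - r)\<^sup>2 + (N - 1) * (F - k\<^sup>2 - q)"
    by (simp add: q right_diff_distrib)
  finally have "(N - 1) * (F - t\<^sup>2 / N) / N = (N * (k - r)\<^sup>2 + (N - 1) * (F - k\<^sup>2 - q)) / N"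
    by simp
  also have "\<dots> = (k - r)\<^sup>2 + (N - 1) * (F - k\<^sup>2 - q) / N"
    using assms by (simp add: add_divide_distrib)
  finally show ?thesis
    by (simp add: q_def r_def)
qed

lemma eigenvalue_le_trace_frobenius:
  fixes A :: "real mat" and t :: real
  assumes A: "A \<in> carrier_mat n n" and n: "n \<ge> 2" and ev: "eigenvector A v k"
    and t: "t = (\<Sum>i<n. A $$ (i, i))"
  defines "b \<equiv> t / real n + sqrt ((real n - 1) / real n * ((frobenius_norm A)\<^sup>2 - t\<^sup>2 / real n))"
  shows "k \<le> b"
    and "k = b \<Longrightarrow> \<exists>\<mu> c. \<forall>i<n. \<forall>j<n. A $$ (i, j) = \<mu> * of_bool (i = j) + c * (v $ i * v $ j)"
proof -
  define \<mu> where "\<mu> = (t - k) / (real n - 1)"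
  define c where "c = (k - \<mu>) / (\<Sum>i<n. (v $ i)\<^sup>2)"
  define R where "R i j = A $$ (i, j) - \<mu> * of_bool (i = j) - c * (v $ i * v $ j)" for i j
  define D where "D = (\<Sum>i<n. \<Sum>j<n. (R i j)\<^sup>2)"
  have D: "D = (frobenius_norm A)\<^sup>2 - k\<^sup>2 - (t - k)\<^sup>2 / (real n - 1)"
    unfolding D_def R_def c_def \<mu>_def by (rule frobenius_residual[OF A n ev t])
  have "D \<ge> 0"
    unfolding D_def by (intro sum_nonneg) simp
  have b: "b = t / real n + sqrt ((k - t / real n)\<^sup>2 + (real n - 1) / real n * D)"
    unfolding b_def D using n by (subst eigenvalue_bound_identity[of "real n"]) auto
  have pos: "0 < (real n - 1) / real n"
    using n by simp
  then have nonneg: "0 \<le> (real n - 1) / real n * D"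
    using \<open>D \<ge> 0\<close> by (intro mult_nonneg_nonneg) auto
  have "k - t / real n \<le> sqrt ((k - t / real n)\<^sup>2 + (real n - 1) / real n * D)"
    using nonneg by (intro real_le_rsqrt) linarith
  then show "k \<le> b"
    by (simp add: b)
  show "\<exists>\<mu> c. \<forall>i<n. \<forall>j<n. A $$ (i, j) = \<mu> * of_bool (i = j) + c * (v $ i * v $ j)" if "k = b"
  proof -
    have "k - t / real n = sqrt ((k - t / real n)\<^sup>2 + (real n - 1) / real n * D)"
      using that b by linarith
    then have "(k - t / real n)\<^sup>2 = (sqrt ((k - t / real n)\<^sup>2 + (real n - 1) / real n * D))\<^sup>2"
      by (rule arg_cong)
    also have "\<dots> = (k - t / real n)\<^sup>2 + (real n - 1) / real n * D"
      using nonneg by (intro real_sqrt_pow2 add_nonneg_nonneg zero_le_power2)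
    finally have "D = 0"
      using n by simp
    then have "\<forall>i<n. (\<Sum>j<n. (R i j)\<^sup>2) = 0"
      unfolding D_def by (subst (asm) sum_nonneg_eq_0_iff) (auto intro: sum_nonneg)
    then have "\<forall>i<n. \<forall>j<n. R i j = 0"
      by (simp add: sum_nonneg_eq_0_iff)
    then have "\<forall>i<n. \<forall>j<n. A $$ (i, j) = \<mu> * of_bool (i = j) + c * (v $ i * v $ j)"
      unfolding R_def by fastforce
    then show ?thesis
      by blast
  qed
qed

text \<open>
  The case \<open>n = 1\<close> lies outside the previous argument, since there are no other eigenvalues to
  average.
\<close>

lemma eigenvalue_one_by_one:
  fixes A :: "real mat"
  assumes A: "A \<in> carrier_mat 1 1" and "eigenvalue A k"
  shows "k = A $$ (0, 0)"
proof -
  obtain v where v: "v \<in> carrier_vec 1" "v \<noteq> 0\<^sub>v 1" and eq: "A *\<^sub>v v = k \<cdot>\<^sub>v v"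
    using assms unfolding eigenvalue_def eigenvector_def by auto
  have "0 < (v $ 0)\<^sup>2"
    using sum_sq_pos[OF v] by simp
  moreover have "A $$ (0, 0) * v $ 0 = k * v $ 0"
    using mult_mat_vec_index_sum[OF A v(1), of 0] eq v(1) by auto
  ultimately show ?thesis
    by simp
qed

section \<open>The distance signless Laplacian\<close>

lemma distance_signless_laplacian_carrier:
  "distance_signless_laplacian G vs \<in> carrier_mat (length vs) (length vs)"
  by (simp add: distance_signless_laplacian_def transmission_matrix_def distance_matrix_def)

lemma distance_signless_laplacian_index:
  assumes "i < length vs" and "j < length vs"
  shows "distance_signless_laplacian G vs $$ (i, j) =
    of_bool (i = j) * real (transmission G (vs ! i)) + real (graph_dist G (vs ! i) (vs ! j))"
  using assms
  by (simp add: distance_signless_laplacian_def transmission_matrix_def distance_matrix_def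
      mat_diag_def)

lemma (in fin_digraph) trace_distance_signless_laplacian:
  assumes "distinct vs" and "set vs = verts G"
  shows "(\<Sum>i<length vs. distance_signless_laplacian G vs $$ (i, i)) = 2 * wiener_index G"
proof -
  have "(\<Sum>i<length vs. distance_signless_laplacian G vs $$ (i, i)) =
      (\<Sum>i<length vs. real (transmission G (vs ! i)))"
  proof (intro sum.cong refl)
    fix i assume "i \<in> {..<length vs}"
    then show "distance_signless_laplacian G vs $$ (i, i) = real (transmission G (vs ! i))"
      using assms(2) nth_mem[of i vs]
      by (simp add: distance_signless_laplacian_index graph_dist_self)
  qed
  also have "\<dots> = (\<Sum>u\<in>verts G. real (transmission G u))"
    using assms by (intro sum.reindex_bij_betw bij_betw_nth) auto
  also have "\<dots> = 2 * wiener_index G"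
    by (simp add: wiener_index_def transmission_def)
  finally show ?thesis .
qed

lemma (in graph) distance_signless_laplacian_sym:
  assumes "Digraph_Component.connected G" and "set vs = verts G"
    and "i < length vs" and "j < length vs"
  shows "distance_signless_laplacian G vs $$ (i, j) = distance_signless_laplacian G vs $$ (j, i)"
proof -
  have "vs ! i \<rightarrow>\<^sup>*\<^bsub>G\<^esub> vs ! j"
    using assms nth_mem by (intro connected_imp_reachable) blast+
  then show ?thesis
    using assms(3,4) graph_dist_commute by (auto simp: distance_signless_laplacian_index)
qed

text \<open>
  The equality case. Along an induced path the three off-diagonal entries determine the products
  \<open>c * (f i * f i)\<close>, and these make two transmissions differ by a non-integer.
\<close>

lemma (in graph) rank_one_perturbation_imp_complete:
  assumes con: "Digraph_Component.connected G" and vs: "set vs = verts G"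
    and eq: "\<forall>i<length vs. \<forall>j<length vs.
      distance_signless_laplacian G vs $$ (i, j) = m * of_bool (i = j) + c * (f i * f j)"
  shows "complete_digraph (card (verts G)) G"
proof (rule ccontr)
  assume "\<not> ?thesis"
  with con obtain u v w where uvw: "u \<rightarrow>\<^bsub>G\<^esub> v" "v \<rightarrow>\<^bsub>G\<^esub> w" "u \<noteq> w" "\<not> u \<rightarrow>\<^bsub>G\<^esub> w"
    by (rule connected_not_complete_imp_induced_path)
  then have "u \<noteq> v" "v \<noteq> w"
    using adj_not_same by blast+
  have "u \<in> set vs" "v \<in> set vs" "w \<in> set vs"
    unfolding vs using uvw(1,2) by (blast dest: adj_in_verts)+
  then obtain a b d where i: "a < length vs" "b < length vs" "d < length vs"
    and n: "vs ! a = u" "vs ! b = v" "vs ! d = w"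
    by (metis in_set_conv_nth)
  then have ne: "a \<noteq> b" "b \<noteq> d" "a \<noteq> d"
    using \<open>u \<noteq> v\<close> \<open>v \<noteq> w\<close> \<open>u \<noteq> w\<close> by auto
  have off: "c * (f k * f l) = real (graph_dist G (vs ! k) (vs ! l))"
    if "k < length vs" "l < length vs" "k \<noteq> l" for k l
    using eq[rule_format, OF that(1,2)] that by (simp add: distance_signless_laplacian_index)
  have diag: "real (transmission G (vs ! k)) = m + c * (f k * f k)" if "k < length vs" for k
    using eq[rule_format, OF that that] that vs nth_mem[OF that]
    by (simp add: distance_signless_laplacian_index graph_dist_self)
  have ab: "c * (f a * f b) = 1"
    using off[of a b] i ne n graph_dist_adjacent[OF uvw(1) \<open>u \<noteq> v\<close>] by simp
  have bd: "c * (f b * f d) = 1"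
    using off[of b d] i ne n graph_dist_adjacent[OF uvw(2) \<open>v \<noteq> w\<close>] by simp
  have ad: "c * (f a * f d) = 2"
    using off[of a d] i ne n graph_dist_common_neighbour[OF uvw] by simp
  have "(c * (f a * f a)) * (c * (f b * f d)) = (c * (f a * f b)) * (c * (f a * f d))"
    by (simp add: mult_ac)
  then have aa: "c * (f a * f a) = 2"
    by (simp add: ab bd ad)
  have "(c * (f a * f a)) * (c * (f b * f b)) = (c * (f a * f b)) * (c * (f a * f b))"
    by (simp add: mult_ac)
  then have bb: "c * (f b * f b) = 1 / 2"
    unfolding aa ab by simp
  \<comment> \<open>Doubled, so that the half-integer difference becomes a parity contradiction.\<close>
  have "2 * real (transmission G u) = 2 * real (transmission G v) + 3"
    using diag[of a] diag[of b] i n aa bb by simp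
  then have "2 * transmission G u = 2 * transmission G v + 3"
    by linarith
  then show False
    by presburger
qed

lemma complete_distance_signless_laplacian_index:
  assumes "complete_digraph n G" and "set vs = verts G" and "distinct vs"
    and "i < length vs" and "j < length vs"
  shows "distance_signless_laplacian G vs $$ (i, j) = 1 + of_bool (i = j) * (real n - 2)"
proof -
  interpret graph G
    using assms(1) by (simp add: complete_digraph_def)
  have card: "card (verts G) = n"
    and arcs: "arcs_ends G = {(u, v). (u, v) \<in> verts G \<times> verts G \<and> u \<noteq> v}"
    using assms(1) by (simp_all add: complete_digraph_def)
  have dist: "graph_dist G u v = of_bool (u \<noteq> v)" if "u \<in> verts G" "v \<in> verts G" for u v
    using that graph_dist_self[of u] graph_dist_adjacent[of u v] arcs by (cases "u = v") auto
  have "vs ! i \<in> verts G" "vs ! j \<in> verts G"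
    using assms(2,4,5) nth_mem by blast+
  moreover from this have "n \<ge> 1"
    using card card_gt_0_iff[of "verts G"] by (auto simp: Suc_le_eq)
  moreover have "transmission G u = n - 1" if "u \<in> verts G" for u
  proof -
    have "transmission G u = (\<Sum>v\<in>verts G. of_bool (u \<noteq> v))"
      unfolding transmission_def using that by (intro sum.cong refl dist)
    also have "\<dots> = (\<Sum>v\<in>verts G - {u}. 1)"
      using that by (intro sum.mono_neutral_cong_right) auto
    also have "\<dots> = n - 1"
      using that by (simp add: card)
    finally show ?thesis .
  qed
  ultimately show ?thesis
    using assms(3-5) by (simp add: distance_signless_laplacian_index dist nth_eq_iff_index_eq)
qed

lemma sum_of_bool_eq:
  fixes a b :: real
  assumes "i < n"
  shows "(\<Sum>j<n. a + of_bool (i = j) * b) = real n * a + b"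
  using assms
  by (simp add: sum.distrib of_bool_def if_distrib[of "\<lambda>x. x * _"] cong: if_cong)

text \<open>
  The matrix here is \<open>J + (n - 2) I\<close> with \<open>J\<close> the all-ones matrix, which is what the distance
  signless Laplacian of \<open>K\<^sub>n\<close> amounts to. The eigenvalue \<open>2 (n - 1)\<close> equals the bound, so that no larger one exists.
\<close>

lemma complete_spectral_data:
  fixes A :: "real mat"
  assumes A: "A \<in> carrier_mat n n" and "n > 0"
    and ix: "\<And>i j. i < n \<Longrightarrow> j < n \<Longrightarrow> A $$ (i, j) = 1 + of_bool (i = j) * (real n - 2)"
  shows "(\<Sum>i<n. A $$ (i, i)) = real n * (real n - 1)"
    and "(frobenius_norm A)\<^sup>2 = real n * (real n - 1)\<^sup>2 + real n * (real n - 1)"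
    and "eigenvalue A (2 * (real n - 1))"
proof -
  show "(\<Sum>i<n. A $$ (i, i)) = real n * (real n - 1)"
    by (simp add: ix)
  have sq: "(A $$ (i, j))\<^sup>2 = 1 + of_bool (i = j) * ((real n - 1)\<^sup>2 - 1)" if "i < n" "j < n" for i j
    using that by (simp add: ix)
  have "(frobenius_norm A)\<^sup>2 = (\<Sum>i<n. \<Sum>j<n. (A $$ (i, j))\<^sup>2)"
    using A by (simp add: frobenius_norm_def sum_nonneg)
  also have "\<dots> = (\<Sum>i<n. \<Sum>j<n. 1 + of_bool (i = j) * ((real n - 1)\<^sup>2 - 1))"
    by (intro sum.cong refl sq) auto
  also have "\<dots> = (\<Sum>i<n. real n * 1 + ((real n - 1)\<^sup>2 - 1))"
    by (intro sum.cong refl sum_of_bool_eq) auto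
  also have "\<dots> = real n * (real n - 1)\<^sup>2 + real n * (real n - 1)"
    by (simp add: algebra_simps)
  finally show "(frobenius_norm A)\<^sup>2 = real n * (real n - 1)\<^sup>2 + real n * (real n - 1)" .
  define e :: "real vec" where "e = vec n (\<lambda>_. 1)"
  have e: "e \<in> carrier_vec n" and "e \<noteq> 0\<^sub>v n"
    using \<open>n > 0\<close> by (auto simp: e_def dest: arg_cong[where f = "\<lambda>v. v $ 0"])
  have "A *\<^sub>v e = (2 * (real n - 1)) \<cdot>\<^sub>v e"
  proof (rule eq_vecI)
    fix i assume "i < dim_vec ((2 * (real n - 1)) \<cdot>\<^sub>v e)"
    then have i: "i < n" by (simp add: e_def)
    have "(A *\<^sub>v e) $ i = (\<Sum>j<n. A $$ (i, j) * e $ j)"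
      using A e i by (rule mult_mat_vec_index_sum)
    also have "\<dots> = (\<Sum>j<n. 1 + of_bool (i = j) * (real n - 2))"
      using i by (intro sum.cong refl) (simp add: ix e_def)
    also have "\<dots> = real n * 1 + (real n - 2)"
      using i by (rule sum_of_bool_eq)
    finally show "(A *\<^sub>v e) $ i = ((2 * (real n - 1)) \<cdot>\<^sub>v e) $ i"
      using i by (simp add: e_def)
  qed (use A in \<open>simp add: e_def\<close>)
  with A e \<open>e \<noteq> 0\<^sub>v n\<close> show "eigenvalue A (2 * (real n - 1))"
    unfolding eigenvalue_def eigenvector_def by auto
qed

lemma complete_bound_value:
  fixes N :: real
  assumes "N \<ge> 1"
  shows "N * (N - 1) / N + sqrt ((N - 1) / N *
    (N * (N - 1)\<^sup>2 + N * (N - 1) - (N * (N - 1))\<^sup>2 / N)) = 2 * (N - 1)"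
proof -
  have "(N - 1) / N * (N * (N - 1)\<^sup>2 + N * (N - 1) - (N * (N - 1))\<^sup>2 / N) = (N - 1)\<^sup>2"
    using assms by (simp add: power2_eq_square)
  then show ?thesis
    using assms by simp
qed

theorem theorem19:
  fixes G :: "('a, 'b) pre_digraph" and n :: nat and vs :: "'a list"
  assumes "graph G" and "Digraph_Component.connected G" and "card (verts G) = n"
    and "distinct vs" and "set vs = verts G"
  defines "Q \<equiv> distance_signless_laplacian G vs"
  defines "bound \<equiv> 2 * wiener_index G / real n
      + sqrt ((real n - 1) / real n * ((frobenius_norm Q)\<^sup>2 - (2 * wiener_index G)\<^sup>2 / real n))"
  shows "nth_largest_eigenvalue Q 1 \<le> bound \<and>
    (nth_largest_eigenvalue Q 1 = bound \<longleftrightarrow> complete_digraph n G)"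
proof -
  interpret graph G by fact
  have len: "length vs = n"
    using assms(3,4,5) distinct_card by metis
  have "verts G \<noteq> {}"
    using assms(2) by (auto simp: connected_def strongly_connected_def)
  then have "n > 0"
    using assms(3) card_gt_0_iff[of "verts G"] by simp
  have Q: "Q \<in> carrier_mat n n"
    unfolding Q_def len[symmetric] by (rule distance_signless_laplacian_carrier)
  have sym: "Q $$ (i, j) = Q $$ (j, i)" if "i < n" "j < n" for i j
    unfolding Q_def using distance_signless_laplacian_sym assms(2,5) that len by simp
  have tr: "2 * wiener_index G = (\<Sum>i<n. Q $$ (i, i))"
    unfolding Q_def len[symmetric] using trace_distance_signless_laplacian assms(4,5) by simp
  define k where "k = nth_largest_eigenvalue Q 1"
  have ev: "eigenvalue Q k"
    unfolding k_def by (rule nth_largest_eigenvalue_1_greatest(1)[OF Q \<open>n > 0\<close> sym])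
  have complete_ge: "bound \<le> k" if "complete_digraph n G"
  proof -
    have ix: "Q $$ (i, j) = 1 + of_bool (i = j) * (real n - 2)" if "i < n" "j < n" for i j
      unfolding Q_def
      by (rule complete_distance_signless_laplacian_index[OF \<open>complete_digraph n G\<close> assms(5,4)])
        (use that len in simp_all)
    have data: "(\<Sum>i<n. Q $$ (i, i)) = real n * (real n - 1)"
        "(frobenius_norm Q)\<^sup>2 = real n * (real n - 1)\<^sup>2 + real n * (real n - 1)"
        "eigenvalue Q (2 * (real n - 1))"
      using complete_spectral_data[OF Q \<open>n > 0\<close>] ix by blast+
    have b: "bound = 2 * (real n - 1)"
      unfolding bound_def tr data(1,2) using \<open>n > 0\<close> by (intro complete_bound_value) simp
    show "bound \<le> k"
      unfolding b k_def
      by (rule nth_largest_eigenvalue_1_greatest(2)[OF Q \<open>n > 0\<close> sym data(3)])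
  qed
  have "k \<le> bound \<and> (k = bound \<longrightarrow> complete_digraph n G)"
  proof (cases "n = 1")
    case True
    obtain x where x: "verts G = {x}"
      using assms(3) True card_1_singletonE by metis
    then have "(u, v) \<notin> arcs_ends G" for u v
      by (metis adj_in_verts adj_not_same singletonD)
    with x have "arcs_ends G = {(u, v). (u, v) \<in> verts G \<times> verts G \<and> u \<noteq> v}"
      by auto
    then have complete: "complete_digraph n G"
      using assms(1,3) by (simp add: complete_digraph_def)
    have "k = Q $$ (0, 0)"
      using eigenvalue_one_by_one Q ev True by blast
    also have "\<dots> = bound"
      using True by (simp add: bound_def tr)
    finally show ?thesis
      using complete by simp
  next
    case False
    then have "n \<ge> 2"
      using \<open>n > 0\<close> by simp
    obtain v where v: "eigenvector Q v k"
      using ev unfolding eigenvalue_def by blast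
    note * = eigenvalue_le_trace_frobenius[OF Q \<open>n \<ge> 2\<close> v tr]
    have "complete_digraph n G" if eq: "k = bound"
    proof -
      obtain m c where "\<forall>i<n. \<forall>j<n. Q $$ (i, j) = m * of_bool (i = j) + c * (v $ i * v $ j)"
        using *(2)[OF eq[unfolded bound_def]] by blast
      then have "complete_digraph (card (verts G)) G"
        unfolding Q_def len[symmetric]
        by (rule rank_one_perturbation_imp_complete[OF assms(2,5), where f = "\<lambda>i. v $ i"])
      then show ?thesis
        by (simp only: assms(3))
    qed
    with *(1) show ?thesis
      unfolding bound_def by blast
  qed
  with complete_ge have "k \<le> bound \<and> (k = bound \<longleftrightarrow> complete_digraph n G)"
    by (metis order_antisym)
  then show ?thesis
    unfolding k_def .
qed

end
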